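(* Let $(\mathcal{X}\times\mathcal{X}_r,\,p(y,y_r|x,x_r),\,\mathcal{Y}\times\mathcal{Y}_r)$ be a discrete memoryless one-way relay channel. Compress-forward without binning achieves the same rate as the original compress-forward scheme; that is, $\mathcal{R}_{\mathrm{NB}}=\mathcal{R}_{\mathrm{CF}}$, where: $\mathcal{R}_{\mathrm{CF}}$ (the rates of the original compress-forward scheme) is the set of all $R\ge0$ such that $$R\leq \min\{\, I(X,X_r;Y)-I(\hat{Y}_r;Y_r|X,X_r,Y),\ \ I(X;Y,\hat{Y}_r|X_r)\,\}$$ for some joint distribution of the form $p(x)p(x_r)p(\hat y_r|y_r,x_r)p(y,y_r|x,x_r)$; $\mathcal{R}_{\mathrm{NB}}$ (the rates of compress-forward without binning) is the set of all $R\ge0$ satisfying the same inequality for some joint distribution of the form $p(x)p(x_r)p(\hat y_r|y_r,x_r)p(y,y_r|x,x_r)$ that in addition satisfies $$I(X_r;Y)+I(\hat{Y}_r;X,Y|X_r)\geq I(\hat{Y}_r;Y_r|X_r).$$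
   Context: The alphabets $\mathcal{X},\mathcal{X}_r,\mathcal{Y},\mathcal{Y}_r$ are finite, and $p(y,y_r|x,x_r)$ is the fixed channel transition law ($X$ sender input, $X_r$ relay input, $Y_r$ relay output, $Y$ receiver output). The distributions over which one ranges are obtained by choosing pmfs $p(x)$ on $\mathcal{X}$ and $p(x_r)$ on $\mathcal{X}_r$, an arbitrary finite alphabet $\hat{\mathcal{Y}}_r$, and a conditional pmf $p(\hat y_r|y_r,x_r)$ on $\hat{\mathcal{Y}}_r$. $(X,X_r,Y,Y_r,\hat Y_r)$ then has joint pmf $p(x)p(x_r)p(y,y_r|x,x_r)p(\hat y_r|y_r,x_r)$. $I(\cdot;\cdot|\cdot)$ denotes (conditional) mutual information. *)

theory Defs
  imports "HOL-Probability.Probability"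
begin

text \<open>
  A relay channel is a kernel \<open>W :: 'x \<Rightarrow> 'xr \<Rightarrow> ('y \<times> 'yr) pmf\<close> over finite types, so that
  \<open>pmf (W x x\<^sub>r) (y, y\<^sub>r)\<close> is \<open>p(y, y\<^sub>r | x, x\<^sub>r)\<close>. In a compression kernel
  \<open>q :: 'yr \<Rightarrow> 'xr \<Rightarrow> 'h pmf\<close>, \<open>q y\<^sub>r x\<^sub>r\<close> is the conditional law of the compressed relay
  output given \<open>Y\<^sub>r = y\<^sub>r\<close>, \<open>X\<^sub>r = x\<^sub>r\<close>; its alphabet is an explicit finite set \<open>A\<close>,
  since it is existentially quantified in the rate regions.
\<close>

definition relay_joint ::
  "'x::finite pmf \<Rightarrow> 'xr::finite pmf \<Rightarrow> ('x \<Rightarrow> 'xr \<Rightarrow> ('y::finite \<times> 'yr::finite) pmf) \<Rightarrow>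
   'h set \<Rightarrow> ('yr \<Rightarrow> 'xr \<Rightarrow> 'h pmf) \<Rightarrow> ('x \<times> 'xr \<times> 'y \<times> 'yr \<times> 'h) measure" where
  "relay_joint p pr W A q =
     point_measure (UNIV \<times> UNIV \<times> UNIV \<times> UNIV \<times> A)
       (\<lambda>(x, xr, y, yr, h).
          ennreal (pmf p x * pmf pr xr * pmf (W x xr) (y, yr) * pmf (q yr xr) h))"

lemma space_relay_joint: "space (relay_joint p pr W A q) = UNIV \<times> UNIV \<times> UNIV \<times> UNIV \<times> A"
  by (simp add: relay_joint_def space_point_measure)

lemma prob_space_relay_joint:
  fixes p :: "'x::finite pmf" and pr :: "'xr::finite pmf"
    and W :: "'x \<Rightarrow> 'xr \<Rightarrow> ('y::finite \<times> 'yr::finite) pmf"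
  assumes A: "finite A" and q: "\<And>yr xr. set_pmf (q yr xr) \<subseteq> A"
  shows "prob_space (relay_joint p pr W A q)"
proof -
  have sq: "(\<Sum>h\<in>A. pmf (q yr xr) h) = 1" for yr xr
    using A q by (intro sum_pmf_eq_1)
  have sW: "(\<Sum>y\<in>UNIV. \<Sum>yr\<in>UNIV. pmf (W x xr) (y, yr)) = 1" for x xr
    by (simp add: sum.cartesian_product sum_pmf_eq_1)
  have "(\<Sum>x\<in>UNIV. \<Sum>xr\<in>UNIV. \<Sum>y\<in>UNIV. \<Sum>yr\<in>UNIV. \<Sum>h\<in>A.
          pmf p x * pmf pr xr * pmf (W x xr) (y, yr) * pmf (q yr xr) h) = 1"
    by (simp add: sum_distrib_left[symmetric] sq sW sum_pmf_eq_1)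
  then have one: "(\<Sum>s\<in>UNIV \<times> UNIV \<times> UNIV \<times> UNIV \<times> A. case s of (x, xr, y, yr, h) \<Rightarrow>
          pmf p x * pmf pr xr * pmf (W x xr) (y, yr) * pmf (q yr xr) h) = 1"
    by (simp add: sum.cartesian_product split_def)
  have "prob_space (point_measure (UNIV \<times> UNIV \<times> UNIV \<times> UNIV \<times> A)
      (\<lambda>s. ennreal (case s of (x, xr, y, yr, h) \<Rightarrow>
          pmf p x * pmf pr xr * pmf (W x xr) (y, yr) * pmf (q yr xr) h)))"
  proof (rule prob_space_point_measure)
    show "finite ((UNIV :: 'x set) \<times> (UNIV :: 'xr set) \<times> (UNIV :: 'y set) \<times> (UNIV :: 'yr set) \<times> A)"
      using A by simp
    show "(\<Sum>s\<in>UNIV \<times> UNIV \<times> UNIV \<times> UNIV \<times> A. ennreal (case s of (x, xr, y, yr, h) \<Rightarrow>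
          pmf p x * pmf pr xr * pmf (W x xr) (y, yr) * pmf (q yr xr) h)) = 1"
      by (subst sum_ennreal) (auto simp: one)
  qed simp
  then show ?thesis
    by (simp add: relay_joint_def split_def)
qed

text \<open>
  The two information quantities are those of \<open>prob_space\<close>, with the discrete
  \<open>\<sigma>\<close>-algebra on the ranges of the random variables (as in \<open>mutual_information_Pow\<close>).
\<close>

definition MI :: "real \<Rightarrow> 'a measure \<Rightarrow> ('a \<Rightarrow> 'b) \<Rightarrow> ('a \<Rightarrow> 'c) \<Rightarrow> real" where
  "MI b M U V = prob_space.mutual_information M b
     (count_space (U ` space M)) (count_space (V ` space M)) U V"

definition CMI :: "real \<Rightarrow> 'a measure \<Rightarrow> ('a \<Rightarrow> 'b) \<Rightarrow> ('a \<Rightarrow> 'c) \<Rightarrow> ('a \<Rightarrow> 'd) \<Rightarrow> real" where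
  "CMI b M U V Z = prob_space.conditional_mutual_information M b
     (count_space (U ` space M)) (count_space (V ` space M)) (count_space (Z ` space M)) U V Z"

definition rvX :: "'x \<times> 'xr \<times> 'y \<times> 'yr \<times> 'h \<Rightarrow> 'x" where
  "rvX = (\<lambda>(x, xr, y, yr, h). x)"

definition rvXr :: "'x \<times> 'xr \<times> 'y \<times> 'yr \<times> 'h \<Rightarrow> 'xr" where
  "rvXr = (\<lambda>(x, xr, y, yr, h). xr)"

definition rvY :: "'x \<times> 'xr \<times> 'y \<times> 'yr \<times> 'h \<Rightarrow> 'y" where
  "rvY = (\<lambda>(x, xr, y, yr, h). y)"

definition rvYr :: "'x \<times> 'xr \<times> 'y \<times> 'yr \<times> 'h \<Rightarrow> 'yr" where
  "rvYr = (\<lambda>(x, xr, y, yr, h). yr)"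

definition rvYhat :: "'x \<times> 'xr \<times> 'y \<times> 'yr \<times> 'h \<Rightarrow> 'h" where
  "rvYhat = (\<lambda>(x, xr, y, yr, h). h)"

definition CF_bound :: "real \<Rightarrow> ('x \<times> 'xr \<times> 'y \<times> 'yr \<times> 'h) measure \<Rightarrow> real" where
  "CF_bound b M =
     min (MI b M (\<lambda>s. (rvX s, rvXr s)) rvY - CMI b M rvYhat rvYr (\<lambda>s. (rvX s, rvXr s, rvY s)))
         (CMI b M rvX (\<lambda>s. (rvY s, rvYhat s)) rvXr)"

definition NB_constraint :: "real \<Rightarrow> ('x \<times> 'xr \<times> 'y \<times> 'yr \<times> 'h) measure \<Rightarrow> bool" where
  "NB_constraint b M \<longleftrightarrow>
     MI b M rvXr rvY + CMI b M rvYhat (\<lambda>s. (rvX s, rvY s)) rvXr \<ge> CMI b M rvYhat rvYr rvXr"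

text \<open>
  Every finite alphabet is, up to relabelling, a finite set of natural numbers, so the
  alphabet \<open>A\<close> ranges over the finite sets of naturals. The base \<open>b\<close> of the logarithm
  is the unit of information (\<open>b = 2\<close> for bits).
\<close>

definition R_CF ::
  "real \<Rightarrow> ('x::finite \<Rightarrow> 'xr::finite \<Rightarrow> ('y::finite \<times> 'yr::finite) pmf) \<Rightarrow> real set" where
  "R_CF b W = {R. 0 \<le> R \<and>
     (\<exists>p pr (A :: nat set) q. finite A \<and> (\<forall>yr xr. set_pmf (q yr xr) \<subseteq> A) \<and>
        R \<le> CF_bound b (relay_joint p pr W A q))}"

definition R_NB ::
  "real \<Rightarrow> ('x::finite \<Rightarrow> 'xr::finite \<Rightarrow> ('y::finite \<times> 'yr::finite) pmf) \<Rightarrow> real set" where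
  "R_NB b W = {R. 0 \<le> R \<and>
     (\<exists>p pr (A :: nat set) q. finite A \<and> (\<forall>yr xr. set_pmf (q yr xr) \<subseteq> A) \<and>
        NB_constraint b (relay_joint p pr W A q) \<and>
        R \<le> CF_bound b (relay_joint p pr W A q))}"

end

theory Submission
  imports Defs
begin

text \<open>
  By the chain rule and nonnegativity,
  \<open>I(Yhat;Yr|Xr) \<le> I(Yhat;X,Y|Xr) + I(Yhat;Yr|X,Xr,Y)\<close>. So if a distribution violates the
  constraint, then \<open>I(Xr;Y) < I(Yhat;Yr|X,Xr,Y)\<close>, and the first term of its bound is below
  \<open>I(X,Xr;Y) - I(Xr;Y) = I(X;Y|Xr)\<close>. That rate is reached with a constant \<open>Yhat\<close>, for which
  the constraint is trivial.
\<close>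

section \<open>Entropy and mutual information of simple functions\<close>

context information_space
begin

lemma entropy_eq_sum:
  assumes "simple_function M X"
  shows "\<H>(X) = - (\<Sum>x\<in>X ` space M. prob (X -` {x} \<inter> space M) * log b (prob (X -` {x} \<inter> space M)))"
  by (rule entropy_simple_distributed[OF simple_distributedI[OF assms measure_nonneg refl]])

text \<open>Entropy depends only on the partition of the space into level sets: equal partitions
  give ranges in bijection, and the entropy sum is merely reindexed. This handles every later
  reordering or renesting of tuples.\<close>

lemma entropy_eqI:
  assumes X: "simple_function M X" and Y: "simple_function M Y"
    and eq: "\<And>s t. s \<in> space M \<Longrightarrow> t \<in> space M \<Longrightarrow> X s = X t \<longleftrightarrow> Y s = Y t"
  shows "\<H>(X) = \<H>(Y)"
proof -
  \<comment> \<open>\<open>g\<close> reads off \<open>Y\<close> at an arbitrary preimage of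
    \<open>x\<close>; by \<open>eq\<close> the value does not depend on the choice.\<close>
  define g where "g = (\<lambda>x. Y (SOME s. s \<in> space M \<and> X s = x))"
  have g: "g (X s) = Y s" if "s \<in> space M" for s
  proof -
    have "\<exists>t. t \<in> space M \<and> X t = X s"
      using that by blast
    from someI_ex[OF this] show ?thesis
      unfolding g_def using eq that by blast
  qed
  have inj: "inj_on g (X ` space M)"
    using g eq by (auto simp: inj_on_def)
  have im: "Y ` space M = g ` X ` space M"
    using g by (force simp: image_image)
  have "Y -` {g x} \<inter> space M = X -` {x} \<inter> space M" if "x \<in> X ` space M" for x
    using that g eq by auto
  then have "(\<Sum>y\<in>Y ` space M. prob (Y -` {y} \<inter> space M) * log b (prob (Y -` {y} \<inter> space M))) =
      (\<Sum>x\<in>X ` space M. prob (X -` {x} \<inter> space M) * log b (prob (X -` {x} \<inter> space M)))"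
    unfolding im by (simp add: sum.reindex[OF inj])
  then show ?thesis
    using X Y by (simp add: entropy_eq_sum)
qed

text \<open>Points outside the range have empty preimage, so the same density formula is already
  zero there. Supersets are needed because a pair is measured on the product of two ranges, which
  may exceed the range of the pair.\<close>

lemma distributed_count_space_superset:
  assumes "simple_function M X" "X ` space M \<subseteq> A" "finite A"
  shows "distributed M (count_space A) X (\<lambda>x. ennreal (prob (X -` {x} \<inter> space M)))"
proof -
  have "(if x \<in> X ` space M then prob (X -` {x} \<inter> space M) else 0) = prob (X -` {x} \<inter> space M)"
    for x
  proof (cases "x \<in> X ` space M")
    case False
    then have "X -` {x} \<inter> space M = {}"
      by auto
    then show ?thesis
      by simp
  qed simp
  with distributed_simple_function_superset[OF assms(1) refl assms(2,3)] show ?thesis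
    by simp
qed

text \<open>Every added point contributes \<open>0 * log b 0 = 0\<close>.\<close>

lemma entropy_count_space_superset:
  assumes X: "simple_function M X" and A: "X ` space M \<subseteq> A" "finite A"
  shows "entropy b (count_space A) X = \<H>(X)"
proof -
  have "X -` {x} \<inter> space M = {}" if "x \<notin> X ` space M" for x
    using that by auto
  then have "(\<Sum>x\<in>A. prob (X -` {x} \<inter> space M) * log b (prob (X -` {x} \<inter> space M))) =
      (\<Sum>x\<in>X ` space M. prob (X -` {x} \<inter> space M) * log b (prob (X -` {x} \<inter> space M)))"
    using A by (intro sum.mono_neutral_right) auto
  then show ?thesis
    using entropy_distr[OF distributed_count_space_superset[OF X A]]
    by (simp add: entropy_eq_sum[OF X] lebesgue_integral_count_space_finite A)
qed

lemma mutual_information_count_space_superset: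
  assumes X: "simple_function M X" and Y: "simple_function M Y"
    and A: "X ` space M \<subseteq> A" "finite A" and B: "Y ` space M \<subseteq> B" "finite B"
  shows "mutual_information b (count_space A) (count_space B) X Y =
    \<H>(X) + \<H>(Y) - \<H>(\<lambda>s. (X s, Y s))"
proof -
  have XY: "simple_function M (\<lambda>s. (X s, Y s))"
    using X Y by (rule simple_function_Pair)
  have eq: "count_space A \<Otimes>\<^sub>M count_space B = count_space (A \<times> B)"
    using A B by (simp add: pair_measure_count_space)
  have AB: "(\<lambda>s. (X s, Y s)) ` space M \<subseteq> A \<times> B" "finite (A \<times> B)"
    using A B by auto
  have "mutual_information b (count_space A) (count_space B) X Y =
      entropy b (count_space A) X + entropy b (count_space B) Y -
      entropy b (count_space A \<Otimes>\<^sub>M count_space B) (\<lambda>s. (X s, Y s))"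
    using distributed_count_space_superset[OF X A] distributed_count_space_superset[OF Y B]
      distributed_count_space_superset[OF XY AB]
    by (intro mutual_information_eq_entropy_conditional_entropy_distr[where
          Px = "\<lambda>x. prob (X -` {x} \<inter> space M)" and Py = "\<lambda>x. prob (Y -` {x} \<inter> space M)" and
          Pxy = "\<lambda>x. prob ((\<lambda>s. (X s, Y s)) -` {x} \<inter> space M)"])
      (use A B in \<open>simp_all add: eq integrable_count_space sigma_finite_measure_count_space_finite\<close>)
  then show ?thesis
    unfolding eq
    by (simp only: entropy_count_space_superset[OF X A] entropy_count_space_superset[OF Y B]
        entropy_count_space_superset[OF XY AB])
qed

lemma mutual_information_eq_entropy:
  assumes "simple_function M X" "simple_function M Y"
  shows "\<I>(X ; Y) = \<H>(X) + \<H>(Y) - \<H>(\<lambda>s. (X s, Y s))"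
  using assms by (intro mutual_information_count_space_superset) (auto simp: simple_functionD)

text \<open>By definition this is I(X;(Y,Z)) - I(X;Z), and \<open>\<H>(X)\<close> cancels. The first
  term lives on the product of the ranges of \<open>Y\<close> and \<open>Z\<close>, hence the
  superset version above.\<close>

lemma conditional_mutual_information_eq_entropy:
  assumes X: "simple_function M X" and Y: "simple_function M Y" and Z: "simple_function M Z"
  shows "\<I>(X ; Y | Z) =
    \<H>(\<lambda>s. (X s, Z s)) + \<H>(\<lambda>s. (Y s, Z s)) - \<H>(\<lambda>s. (X s, Y s, Z s)) - \<H>(Z)"
proof -
  have "count_space (Y ` space M) \<Otimes>\<^sub>M count_space (Z ` space M) =
      count_space (Y ` space M \<times> Z ` space M)"
    using Y Z by (simp add: pair_measure_count_space simple_functionD)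
  moreover have "mutual_information b (count_space (X ` space M))
      (count_space (Y ` space M \<times> Z ` space M)) X (\<lambda>s. (Y s, Z s)) =
      \<H>(X) + \<H>(\<lambda>s. (Y s, Z s)) - \<H>(\<lambda>s. (X s, Y s, Z s))"
    using X Y Z
    by (intro mutual_information_count_space_superset simple_function_Pair)
      (auto simp: simple_functionD)
  ultimately show ?thesis
    using mutual_information_eq_entropy[OF X Z] by (simp add: conditional_mutual_information_def)
qed

lemma mutual_information_chain_rule:
  assumes sf: "simple_function M X" "simple_function M Y" "simple_function M Z"
  shows "\<I>(\<lambda>s. (X s, Z s) ; Y) = \<I>(Z ; Y) + \<I>(X ; Y | Z)"
proof -
  have "\<H>(\<lambda>s. ((X s, Z s), Y s)) = \<H>(\<lambda>s. (X s, Y s, Z s))"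
    "\<H>(\<lambda>s. (Z s, Y s)) = \<H>(\<lambda>s. (Y s, Z s))"
    by (auto intro!: entropy_eqI simple_function_Pair sf)
  then show ?thesis
    by (simp add: mutual_information_eq_entropy conditional_mutual_information_eq_entropy
        simple_function_Pair sf)
qed

text \<open>Two chain-rule expansions of I(U;T,X,Y|Z) show that the right side exceeds the left by
  exactly I(U;X,Y|T,Z), which is nonnegative. The conditioning triple is ordered as in
  \<open>CF_bound\<close>.\<close>

lemma conditional_mutual_information_le_add:
  assumes sf: "simple_function M U" "simple_function M T" "simple_function M X"
    "simple_function M Y" "simple_function M Z"
  shows "\<I>(U ; T | Z) \<le> \<I>(U ; \<lambda>s. (X s, Y s) | Z) + \<I>(U ; T | \<lambda>s. (X s, Z s, Y s))"
proof -
  have "0 \<le> \<I>(U ; \<lambda>s. (X s, Y s) | \<lambda>s. (T s, Z s))"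
    by (intro conditional_mutual_information_nonneg simple_function_Pair sf)
  moreover have
    "\<H>(\<lambda>s. (U s, T s, X s, Z s, Y s)) = \<H>(\<lambda>s. (U s, (X s, Y s), T s, Z s))"
    "\<H>(\<lambda>s. (T s, X s, Z s, Y s)) = \<H>(\<lambda>s. ((X s, Y s), T s, Z s))"
    "\<H>(\<lambda>s. (U s, X s, Z s, Y s)) = \<H>(\<lambda>s. (U s, (X s, Y s), Z s))"
    "\<H>(\<lambda>s. (X s, Z s, Y s)) = \<H>(\<lambda>s. ((X s, Y s), Z s))"
    by (auto intro!: entropy_eqI simple_function_Pair sf)
  ultimately show ?thesis
    by (simp add: conditional_mutual_information_eq_entropy simple_function_Pair sf)
qed

text \<open>A constant component does not refine the partition into level sets, so it drops out of
  each joint entropy and the four terms cancel.\<close>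

lemma conditional_mutual_information_const:
  assumes sf: "simple_function M U" "simple_function M T" "simple_function M Z"
    and U: "\<And>s. s \<in> space M \<Longrightarrow> U s = c"
  shows "\<I>(U ; T | Z) = 0"
proof -
  have "\<H>(\<lambda>s. (U s, Z s)) = \<H>(Z)" "\<H>(\<lambda>s. (U s, T s, Z s)) = \<H>(\<lambda>s. (T s, Z s))"
    by (intro entropy_eqI simple_function_Pair sf; simp add: U)+
  then show ?thesis
    by (simp add: conditional_mutual_information_eq_entropy simple_function_Pair sf)
qed

lemma conditional_mutual_information_Pair_const:
  assumes sf: "simple_function M X" "simple_function M Y" "simple_function M U" "simple_function M Z"
    and U: "\<And>s. s \<in> space M \<Longrightarrow> U s = c"
  shows "\<I>(X ; \<lambda>s. (Y s, U s) | Z) = \<I>(X ; Y | Z)"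
proof -
  have "\<H>(\<lambda>s. ((Y s, U s), Z s)) = \<H>(\<lambda>s. (Y s, Z s))"
    "\<H>(\<lambda>s. (X s, (Y s, U s), Z s)) = \<H>(\<lambda>s. (X s, Y s, Z s))"
    by (intro entropy_eqI simple_function_Pair sf; simp add: U)+
  then show ?thesis
    by (simp add: conditional_mutual_information_eq_entropy simple_function_Pair sf)
qed

end

section \<open>Marginals of the relay distribution that do not involve the compression\<close>

lemma simple_function_relay_joint:
  assumes "finite A"
  shows "simple_function (relay_joint p pr W A q) f"
  unfolding relay_joint_def simple_function_def using assms
  by (auto simp: space_point_measure sets_point_measure)

lemma information_space_relay_joint:
  assumes "finite A" "\<And>yr xr. set_pmf (q yr xr) \<subseteq> A" "1 < b"
  shows "information_space (relay_joint p pr W A q) b"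
  using assms
  by (intro information_space.intro information_space_axioms.intro prob_space_relay_joint)

text \<open>For each \<open>yr\<close>, \<open>xr\<close> the weights \<open>q yr xr\<close> sum to
  1 over \<open>A\<close>, so summing out \<open>h\<close> removes both \<open>A\<close> and
  \<open>q\<close>. This independence is what permits exchanging the compression kernel.\<close>

lemma measure_relay_joint_marginal:
  fixes g :: "'x::finite \<times> 'xr::finite \<times> 'y::finite \<times> 'yr::finite \<Rightarrow> 'u"
    and p pr W and q :: "'yr \<Rightarrow> 'xr \<Rightarrow> 'h pmf"
  assumes A: "finite A" and q: "\<And>yr xr. set_pmf (q yr xr) \<subseteq> A"
  defines "M \<equiv> relay_joint p pr W A q"
  shows "measure M ((\<lambda>(x, xr, y, yr, h). g (x, xr, y, yr)) -` {u} \<inter> space M) =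
    (\<Sum>x\<in>UNIV. \<Sum>xr\<in>UNIV. \<Sum>y\<in>UNIV. \<Sum>yr\<in>UNIV.
       if g (x, xr, y, yr) = u then pmf p x * pmf pr xr * pmf (W x xr) (y, yr) else 0)"
proof -
  let ?w = "\<lambda>(x, xr, y, yr, h). pmf p x * pmf pr xr * pmf (W x xr) (y, yr) * pmf (q yr xr) h"
  let ?S = "(UNIV :: 'x set) \<times> (UNIV :: 'xr set) \<times> (UNIV :: 'y set) \<times> (UNIV :: 'yr set) \<times> A"
  let ?E = "(\<lambda>(x, xr, y, yr, h). g (x, xr, y, yr)) -` {u}"
  have sq: "(\<Sum>h\<in>A. pmf (q yr xr) h) = 1" for yr xr
    using A q by (intro sum_pmf_eq_1)
  have M: "M = point_measure ?S (\<lambda>s. ennreal (?w s))"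
    by (simp add: M_def relay_joint_def split_def)
  have "emeasure M (?E \<inter> ?S) = (\<Sum>s\<in>?E \<inter> ?S. ennreal (?w s))"
    unfolding M using A by (intro emeasure_point_measure_finite) auto
  also have "\<dots> = ennreal (\<Sum>s\<in>?E \<inter> ?S. ?w s)"
    by (intro sum_ennreal) auto
  finally have "measure M (?E \<inter> ?S) = (\<Sum>s\<in>?E \<inter> ?S. ?w s)"
    by (simp add: measure_def split_def sum_nonneg)
  also have "\<dots> = (\<Sum>s\<in>?S. if s \<in> ?E then ?w s else 0)"
    using A by (subst sum.inter_restrict[symmetric]) (auto intro!: sum.cong)
  also have "\<dots> = (\<Sum>(x, xr, y, yr, h)\<in>?S. if g (x, xr, y, yr) = u
       then pmf p x * pmf pr xr * pmf (W x xr) (y, yr) * pmf (q yr xr) h else 0)"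
    by (intro sum.cong) auto
  also have "\<dots> = (\<Sum>x\<in>UNIV. \<Sum>xr\<in>UNIV. \<Sum>y\<in>UNIV. \<Sum>yr\<in>UNIV. \<Sum>h\<in>A.
       if g (x, xr, y, yr) = u
       then pmf p x * pmf pr xr * pmf (W x xr) (y, yr) * pmf (q yr xr) h else 0)"
    by (simp add: sum.cartesian_product split_def)
  also have "\<dots> = (\<Sum>x\<in>UNIV. \<Sum>xr\<in>UNIV. \<Sum>y\<in>UNIV. \<Sum>yr\<in>UNIV.
       if g (x, xr, y, yr) = u then pmf p x * pmf pr xr * pmf (W x xr) (y, yr) else 0)"
    by (intro sum.cong refl) (simp add: sum_distrib_left[symmetric] sq)
  finally show ?thesis
    by (simp add: M_def space_relay_joint)
qed

lemma entropy_relay_joint_marginal: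
  fixes g :: "'x::finite \<times> 'xr::finite \<times> 'y::finite \<times> 'yr::finite \<Rightarrow> 'u"
    and p pr W and q :: "'yr \<Rightarrow> 'xr \<Rightarrow> 'h pmf" and q' :: "'yr \<Rightarrow> 'xr \<Rightarrow> 'k pmf"
  assumes A: "finite A" "\<And>yr xr. set_pmf (q yr xr) \<subseteq> A"
    and A': "finite A'" "\<And>yr xr. set_pmf (q' yr xr) \<subseteq> A'"
    and b: "1 < b"
  defines "M \<equiv> relay_joint p pr W A q" and "M' \<equiv> relay_joint p pr W A' q'"
    and "G \<equiv> (\<lambda>(x, xr, y, yr, h :: 'h). g (x, xr, y, yr))"
    and "G' \<equiv> (\<lambda>(x, xr, y, yr, h :: 'k). g (x, xr, y, yr))"
  shows "prob_space.entropy M b (count_space (G ` space M)) G =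
    prob_space.entropy M' b (count_space (G' ` space M')) G'"
proof -
  interpret M: information_space M b
    unfolding M_def using A b by (rule information_space_relay_joint)
  interpret M': information_space M' b
    unfolding M'_def using A' b by (rule information_space_relay_joint)
  \<comment> \<open>The sample space contains all tuples, including those of probability zero, so
    the image is the full range of \<open>g\<close> once the alphabet is nonempty;
    \<open>not_empty\<close> supplies that.\<close>
  have im: "G ` space M = range g" "G' ` space M' = range g"
    using M.not_empty M'.not_empty
    by (force simp: G_def M_def G'_def M'_def space_relay_joint)+
  have sf: "simple_function M G" "simple_function M' G'"
    using A A' by (simp_all add: M_def M'_def simple_function_relay_joint)
  have "measure M (G -` {u} \<inter> space M) = measure M' (G' -` {u} \<inter> space M')" for u
    unfolding M_def M'_def G_def G'_def
    by (subst measure_relay_joint_marginal[OF A], subst measure_relay_joint_marginal[OF A']) (rule refl)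
  then show ?thesis
    unfolding M.entropy_eq_sum[OF sf(1)] M'.entropy_eq_sum[OF sf(2)] by (simp add: im)
qed

text \<open>I(X;Y|Xr) is a combination of four entropies of functions of (x, xr, y, yr), and none of
  them sees the compression.\<close>

lemma CMI_relay_joint_cong:
  assumes A: "finite A" "\<And>yr xr. set_pmf (q yr xr) \<subseteq> A"
    and A': "finite A'" "\<And>yr xr. set_pmf (q' yr xr) \<subseteq> A'"
    and b: "1 < b"
  shows "CMI b (relay_joint p pr W A q) rvX rvY rvXr = CMI b (relay_joint p pr W A' q') rvX rvY rvXr"
proof -
  interpret M: information_space "relay_joint p pr W A q" b
    using A b by (rule information_space_relay_joint)
  interpret M': information_space "relay_joint p pr W A' q'" b
    using A' b by (rule information_space_relay_joint)
  note marg = entropy_relay_joint_marginal[where p = p and pr = pr and W = W and q = q and q' = q', OF A A' b]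
  show ?thesis
    using marg[where g = "\<lambda>(x, xr, y, yr). xr"] marg[where g = "\<lambda>(x, xr, y, yr). (x, xr)"]
      marg[where g = "\<lambda>(x, xr, y, yr). (y, xr)"] marg[where g = "\<lambda>(x, xr, y, yr). (x, y, xr)"]
    by (simp add: CMI_def M.conditional_mutual_information_eq_entropy
        M'.conditional_mutual_information_eq_entropy simple_function_relay_joint A A'
        rvX_def rvXr_def rvY_def split_def)
qed

section \<open>Comparing the rate bound with I(X;Y|Xr)\<close>

lemma CF_bound_le_CMI:
  assumes A: "finite A" "\<And>yr xr. set_pmf (q yr xr) \<subseteq> A" and b: "1 < b"
    and not_NB: "\<not> NB_constraint b (relay_joint p pr W A q)"
  shows "CF_bound b (relay_joint p pr W A q) \<le> CMI b (relay_joint p pr W A q) rvX rvY rvXr"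
proof -
  interpret M: information_space "relay_joint p pr W A q" b
    using A b by (rule information_space_relay_joint)
  note sf = simple_function_relay_joint[OF A(1), where p = p and pr = pr and W = W and q = q]
  show ?thesis
    \<comment> \<open>Only the first argument of the \<open>min\<close> is estimated: the chain rule
      splits I(X,Xr;Y) into I(Xr;Y) + I(X;Y|Xr), and the subtracted term exceeds I(Xr;Y).\<close>
    using not_NB M.mutual_information_chain_rule[OF sf sf sf, of rvX rvXr rvY]
      M.conditional_mutual_information_le_add[OF sf sf sf sf sf, of rvYhat rvYr rvXr rvX rvY]
    by (simp add: CF_bound_def NB_constraint_def MI_def CMI_def)
qed

text \<open>On a one-point alphabet every information term with \<open>rvYhat\<close> as first
  argument vanishes. The constraint reduces to 0 \<le> I(Xr;Y), and the two arguments of the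
  \<open>min\<close> become I(X,Xr;Y) and I(X;Y|Xr).\<close>

lemma constant_compression:
  fixes p pr W and c :: 'h
  assumes b: "1 < b"
  defines "M \<equiv> relay_joint p pr W {c} (\<lambda>_ _. return_pmf c)"
  shows "NB_constraint b M" and "CF_bound b M = CMI b M rvX rvY rvXr"
proof -
  interpret M: information_space M b
    unfolding M_def using b by (intro information_space_relay_joint) auto
  note sf = simple_function_relay_joint[where A = "{c}" and p = p and pr = pr and W = W
      and q = "\<lambda>_ _. return_pmf c", folded M_def, OF finite.insertI[OF finite.emptyI]]
  have const: "rvYhat s = c" if "s \<in> space M" for s
    using that by (auto simp: M_def space_relay_joint rvYhat_def)
  show "NB_constraint b M"
    using M.mutual_information_nonneg_simple[OF sf sf, of rvXr rvY]
      M.conditional_mutual_information_const[where U = rvYhat and T = rvYr and Z = rvXr, OF sf sf sf const]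
      M.conditional_mutual_information_const[where U = rvYhat and T = "\<lambda>s. (rvX s, rvY s)"
        and Z = rvXr, OF sf sf sf const]
    by (simp add: NB_constraint_def MI_def CMI_def)
  show "CF_bound b M = CMI b M rvX rvY rvXr"
    \<comment> \<open>Nonnegativity of I(Xr;Y) decides the \<open>min\<close>: by the chain rule the
      first argument is I(Xr;Y) + I(X;Y|Xr), at least the second.\<close>
    using M.mutual_information_nonneg_simple[OF sf sf, of rvXr rvY]
      M.conditional_mutual_information_const[where U = rvYhat and T = rvYr
        and Z = "\<lambda>s. (rvX s, rvXr s, rvY s)", OF sf sf sf const]
      M.conditional_mutual_information_Pair_const[where X = rvX and Y = rvY and U = rvYhat
        and Z = rvXr, OF sf sf sf sf const]
      M.mutual_information_chain_rule[OF sf sf sf, of rvX rvXr rvY]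
    by (simp add: CF_bound_def MI_def CMI_def)
qed

theorem theorem2:
  fixes W :: "'x::finite \<Rightarrow> 'xr::finite \<Rightarrow> ('y::finite \<times> 'yr::finite) pmf"
    and b :: real
  assumes "1 < b"
  shows "R_NB b W = R_CF b W"
proof
  show "R_NB b W \<subseteq> R_CF b W"
    unfolding R_NB_def R_CF_def by (intro Collect_mono) meson
  show "R_CF b W \<subseteq> R_NB b W"
  proof
    fix R assume "R \<in> R_CF b W"
    then obtain p pr and A :: "nat set" and q where R: "0 \<le> R"
      and A: "finite A" "\<And>yr xr. set_pmf (q yr xr) \<subseteq> A"
      and le: "R \<le> CF_bound b (relay_joint p pr W A q)"
      unfolding R_CF_def mem_Collect_eq by metis
    show "R \<in> R_NB b W"
    proof (cases "NB_constraint b (relay_joint p pr W A q)")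
      case True
      then show ?thesis
        unfolding R_NB_def mem_Collect_eq using R A le by meson
    next
      case False
      \<comment> \<open>The input laws \<open>p\<close> and \<open>pr\<close> are kept and only the
        compression is replaced, by a point mass, so that I(X;Y|Xr) is unchanged.\<close>
      let ?q' = "\<lambda>(_ :: 'yr) (_ :: 'xr). return_pmf (0 :: nat)"
      let ?M' = "relay_joint p pr W {0} ?q'"
      have "R \<le> CMI b (relay_joint p pr W A q) rvX rvY rvXr"
        using le CF_bound_le_CMI[OF A assms False] by linarith
      also have "\<dots> = CMI b ?M' rvX rvY rvXr"
        using A assms by (intro CMI_relay_joint_cong) auto
      also have "\<dots> = CF_bound b ?M'"
        by (rule constant_compression(2)[OF assms, symmetric])
      finally have "R \<le> CF_bound b ?M'" .
      moreover have "NB_constraint b ?M'"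
        using assms by (rule constant_compression(1))
      moreover have "finite {0 :: nat}" "\<forall>yr xr. set_pmf (?q' yr xr) \<subseteq> {0}"
        by simp_all
      ultimately show ?thesis
        unfolding R_NB_def mem_Collect_eq using R by meson
    qed
  qed
qed

end
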